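(* Let $r\ge1$ and $\mathbb A=\{1,\dots,r\}$. Then $$\mathrm{Ferm}(1)\times\mathrm{Bos}(1)\equiv1\pmod{\mathcal I(SH)},$$ where $\mathrm{Ferm}(1)$, $\mathrm{Bos}(1)$, $SH$ and $\mathcal I(SH)$ are as defined in the context.
   Context: A biword on $\mathbb A$ is a $2\times n$ matrix $\binom{x_1\cdots x_n}{a_1\cdots a_n}$ with entries in $\mathbb A$, viewed as a word in biletters and multiplied by concatenation. Formal (possibly infinite) integer linear combinations of biwords form an algebra. For a word $w$, $\mathrm{inv}\,w$ is the number of pairs $i<j$ with $w_i>w_j$, and $\overline w$ is the nondecreasing rearrangement of $w$. Define $$\mathrm{Bos}(1)=\sum_{w\in\mathbb A^*}\binom{\overline w}{w}$$ and $$\mathrm{Ferm}(1)=\sum_{J\subseteq\mathbb A}(-1)^{|J|}\sum_{\sigma\in\mathfrak S_J}(-1)^{\mathrm{inv}\,\sigma}\binom{\sigma(i_1)\cdots\sigma(i_l)}{i_1\cdots i_l},$$ where $J=\{i_1<\dots<i_l\}$ and $\mathrm{inv}\,\sigma=\mathrm{inv}(\sigma(i_1)\cdots\sigma(i_l))$. The empty $J$ contributes $1$. Let $V(x,y,a,b)=(a-x-\tfrac12)(a-y-\tfrac12)(b-x-\tfrac12)(b-y-\tfrac12)$. The system $SH$ consists of the relations, for all $x>y$ and all $a,b$: - $\binom{xy}{ab}=\binom{yx}{ab}$ if $V>0$; - $\binom{xy}{ab}=\binom{yx}{ba}$ if $V<0$. $\mathcal I(SH)$ is the two-sided ideal generated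 by the differences of the two sides of these relations. $E\equiv F\pmod{\mathcal I(SH)}$ means that, for every $n$, the length-$n$ homogeneous component of $E-F$ lies in this ideal. *)

theory Defs
  imports Complex_Main "HOL-Algebra.Ideal" "HOL-Combinatorics.Permutations"
begin

text \<open>The biword with top row \<open>x\<^sub>1 \<dots> x\<^sub>n\<close> and bottom row \<open>a\<^sub>1 \<dots> a\<^sub>n\<close> is the list of biletters
  \<open>[(x\<^sub>1, a\<^sub>1), \<dots>, (x\<^sub>n, a\<^sub>n)]\<close>; a formal linear combination is its coefficient function.\<close>

type_synonym biword = "(nat \<times> nat) list"
type_synonym bseries = "biword \<Rightarrow> int"

definition alphabet :: "nat \<Rightarrow> nat set" where
  "alphabet r = {1..r}"

definition biword :: "nat list \<Rightarrow> nat list \<Rightarrow> biword" where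
  "biword xs as = zip xs as"

definition biwords :: "nat \<Rightarrow> biword set" where
  "biwords r = lists (alphabet r \<times> alphabet r)"

definition single :: "biword \<Rightarrow> bseries" where
  "single u = (\<lambda>v. if v = u then 1 else 0)"

definition series_mult :: "bseries \<Rightarrow> bseries \<Rightarrow> bseries" where
  "series_mult E F = (\<lambda>w. \<Sum>k\<le>length w. E (take k w) * F (drop k w))"

definition biword_algebra :: "nat \<Rightarrow> bseries ring" where
  "biword_algebra r =
    \<lparr>carrier = {E. \<forall>u. E u \<noteq> 0 \<longrightarrow> u \<in> biwords r},
     monoid.mult = series_mult, one = single [],
     zero = (\<lambda>_. 0), add = (\<lambda>E F u. E u + F u)\<rparr>"

definition inversions :: "nat list \<Rightarrow> nat" where
  "inversions w = card {(i, j). i < j \<and> j < length w \<and> w ! i > w ! j}"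

text \<open>The coefficient of \<open>u\<close> in the infinite sum is the number of words \<open>w\<close> whose summand is \<open>u\<close>.\<close>

definition Bos :: "nat \<Rightarrow> bseries" where
  "Bos r = (\<lambda>u. int (card {w \<in> lists (alphabet r). biword (sort w) w = u}))"

definition Ferm :: "nat \<Rightarrow> bseries" where
  "Ferm r = (\<lambda>u. \<Sum>J\<in>Pow (alphabet r). (-1) ^ card J *
     (\<Sum>\<sigma> | \<sigma> permutes J.
        (-1) ^ inversions (map \<sigma> (sorted_list_of_set J)) *
        single (biword (map \<sigma> (sorted_list_of_set J)) (sorted_list_of_set J)) u))"

definition V :: "nat \<Rightarrow> nat \<Rightarrow> nat \<Rightarrow> nat \<Rightarrow> real" where
  "V x y a b = (real a - real x - 1/2) * (real a - real y - 1/2) *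
               (real b - real x - 1/2) * (real b - real y - 1/2)"

definition SH :: "nat \<Rightarrow> (biword \<times> biword) set" where
  "SH r =
     {(biword [x, y] [a, b], biword [y, x] [a, b]) | x y a b.
        {x, y, a, b} \<subseteq> alphabet r \<and> x > y \<and> V x y a b > 0} \<union>
     {(biword [x, y] [a, b], biword [y, x] [b, a]) | x y a b.
        {x, y, a, b} \<subseteq> alphabet r \<and> x > y \<and> V x y a b < 0}"

definition SH_ideal :: "nat \<Rightarrow> bseries set" where
  "SH_ideal r = Idl\<^bsub>biword_algebra r\<^esub> {single u - single v | u v. (u, v) \<in> SH r}"

definition homogeneous_component :: "nat \<Rightarrow> bseries \<Rightarrow> bseries" where
  "homogeneous_component n E = (\<lambda>u. if length u = n then E u else 0)"

definition cong_SH :: "nat \<Rightarrow> bseries \<Rightarrow> bseries \<Rightarrow> bool" where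
  "cong_SH r E F \<longleftrightarrow> (\<forall>n. homogeneous_component n (E - F) \<in> SH_ideal r)"

text \<open>\<^const>\<open>genideal\<close> is an intersection over the ideals of a ring, so it is meaningful only
  because \<^const>\<open>biword_algebra\<close> is a ring containing the generators.\<close>

lemma series_mult_assoc:
  "series_mult (series_mult E F) G = series_mult E (series_mult F G)"
proof
  fix w :: biword
  let ?n = "length w"
  let ?t = "\<lambda>i k. E (take i w) * F (drop i (take k w)) * G (drop k w)"
  have "series_mult (series_mult E F) G w = (\<Sum>k\<le>?n. \<Sum>i\<le>k. ?t i k)"
    unfolding series_mult_def
    by (intro sum.cong) (auto simp: sum_distrib_right min_def intro!: sum.cong)
  also have "\<dots> = (\<Sum>(k, i)\<in>(SIGMA k:{..?n}. {..k}). ?t i k)"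
    by (subst sum.Sigma) auto
  also have "\<dots> = (\<Sum>(i, j)\<in>(SIGMA i:{..?n}. {..?n - i}). ?t i (i + j))"
    by (rule sum.reindex_bij_witness
          [where i = "\<lambda>(i, j). (i + j, i)" and j = "\<lambda>(k, i). (i, k - i)"]) auto
  also have "\<dots> = (\<Sum>i\<le>?n. \<Sum>j\<le>?n - i. ?t i (i + j))"
    by (subst sum.Sigma) auto
  also have "\<dots> = series_mult E (series_mult F G) w"
    unfolding series_mult_def
    by (intro sum.cong)
       (auto simp: sum_distrib_left drop_take mult.assoc add.commute intro!: sum.cong)
  finally show "series_mult (series_mult E F) G w = series_mult E (series_mult F G) w" .
qed

lemma series_mult_one_left: "series_mult (single []) E = E"
proof
  fix w :: biword
  have "series_mult (single []) E w = (\<Sum>k\<le>length w. if k = 0 then E w else 0)"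
    unfolding series_mult_def single_def by (intro sum.cong) auto
  then show "series_mult (single []) E w = E w" by simp
qed

lemma series_mult_one_right: "series_mult E (single []) = E"
proof
  fix w :: biword
  have "series_mult E (single []) w = (\<Sum>k\<le>length w. if k = length w then E w else 0)"
    unfolding series_mult_def single_def by (intro sum.cong) auto
  then show "series_mult E (single []) w = E w" by simp
qed

lemma series_mult_closed:
  assumes "\<And>u. E u \<noteq> 0 \<Longrightarrow> u \<in> biwords r" "\<And>u. F u \<noteq> 0 \<Longrightarrow> u \<in> biwords r"
    and "series_mult E F w \<noteq> 0"
  shows "w \<in> biwords r"
proof -
  obtain k where "E (take k w) * F (drop k w) \<noteq> 0"
    using assms(3) unfolding series_mult_def by (meson sum.neutral)
  then have "take k w \<in> biwords r" "drop k w \<in> biwords r"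
    using assms(1,2) by auto
  then have "take k w @ drop k w \<in> biwords r"
    unfolding biwords_def by (simp only: append_in_lists_conv)
  then show ?thesis by simp
qed

lemma series_mult_distribs:
  "series_mult (\<lambda>u. E u + F u) G = (\<lambda>u. series_mult E G u + series_mult F G u)"
  "series_mult G (\<lambda>u. E u + F u) = (\<lambda>u. series_mult G E u + series_mult G F u)"
  by (simp_all add: series_mult_def algebra_simps sum.distrib)

lemma single_Nil_closed: "single [] u \<noteq> 0 \<Longrightarrow> u \<in> biwords r"
  by (auto simp: single_def biwords_def split: if_splits)

lemma ring_biword_algebra: "ring (biword_algebra r)"
proof (intro ringI abelian_groupI monoidI)
  fix E assume E: "E \<in> carrier (biword_algebra r)"
  show "\<exists>F\<in>carrier (biword_algebra r).
          F \<oplus>\<^bsub>biword_algebra r\<^esub> E = \<zero>\<^bsub>biword_algebra r\<^esub>"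
    using E by (intro bexI[of _ "\<lambda>u. - E u"]) (auto simp: biword_algebra_def)
next
  fix E F assume "E \<in> carrier (biword_algebra r)" "F \<in> carrier (biword_algebra r)"
  then show "E \<otimes>\<^bsub>biword_algebra r\<^esub> F \<in> carrier (biword_algebra r)"
    by (auto simp: biword_algebra_def intro: series_mult_closed)
next
  fix E F assume E: "E \<in> carrier (biword_algebra r)" and F: "F \<in> carrier (biword_algebra r)"
  show "E \<oplus>\<^bsub>biword_algebra r\<^esub> F \<in> carrier (biword_algebra r)"
  proof -
    have "u \<in> biwords r" if "E u + F u \<noteq> 0" for u
      using that E F by (cases "E u = 0") (auto simp: biword_algebra_def)
    then show ?thesis by (simp add: biword_algebra_def)
  qed
qed (auto simp: biword_algebra_def series_mult_assoc series_mult_one_left series_mult_one_right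
      series_mult_distribs single_Nil_closed add.assoc add.commute)

lemma SH_generators_closed:
  "{single u - single v | u v. (u, v) \<in> SH r} \<subseteq> carrier (biword_algebra r)"
  by (auto simp: SH_def biword_algebra_def single_def biword_def biwords_def split: if_splits)

end

theory Submission
  imports Defs "HOL-Combinatorics.Multiset_Permutations"
begin

text \<open>
  The relations of \<^const>\<open>SH\<close> identify biwords with biwords, so a finitely supported series lies in
  the ideal as soon as its pairing with every integer-valued function \<open>f\<close> on biwords that is
  constant on the resulting classes vanishes. As \<open>V x y a b\<close> is never zero and is symmetric in
  \<open>a, b\<close>, either case of the relations makes such an \<open>f\<close> satisfy the ``right-quantum'' identity
  \<open>f(xy/ab) + f(xy/ba) = f(yx/ab) + f(yx/ba)\<close>, and only this identity is used.

  It says that signed sums over the rearrangements of the top row alternate in the bottom row, and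
  that sums over the rearrangements of the bottom row are symmetric in the top row. Consequently
  the Koszul differential, which moves the last factor of an antisymmetric tensor into the
  symmetric algebra, commutes with the coaction of the biletters. The pairing of
  \<open>Ferm(1) \<times> Bos(1)\<close> with \<open>f\<close> is the supertrace of this coaction on the Koszul complex. It vanishes
  in positive degree because a summand \<open>(J, w)\<close> whose overall maximum lies in \<open>J\<close> is matched
  with one whose maximum lies only in \<open>w\<close>.
\<close>

subsection \<open>Adjacent transpositions and inversions\<close>

definition adj_swap :: "nat \<Rightarrow> 'a list \<Rightarrow> 'a list" where
  "adj_swap i xs = xs[i := xs ! Suc i, Suc i := xs ! i]"

lemma adj_swap_append:
  "length us = i \<Longrightarrow> adj_swap i (us @ x # y # vs) = us @ y # x # vs"
  by (auto simp: adj_swap_def list_update_append nth_append)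

lemma split_at_adjacent:
  assumes "Suc i < length xs"
  obtains us x y vs where "xs = us @ x # y # vs" "length us = i"
proof -
  have "xs = take i xs @ xs ! i # xs ! Suc i # drop (Suc (Suc i)) xs"
    using assms by (metis Cons_nth_drop_Suc Suc_lessD append_take_drop_id)
  then show ?thesis using that[of "take i xs"] assms by simp
qed

lemma length_adj_swap [simp]: "length (adj_swap i xs) = length xs"
  by (simp add: adj_swap_def)

lemma mset_adj_swap: "Suc i < length xs \<Longrightarrow> mset (adj_swap i xs) = mset xs"
  by (erule split_at_adjacent) (simp add: adj_swap_append)

lemma adj_swap_adj_swap: "Suc i < length xs \<Longrightarrow> adj_swap i (adj_swap i xs) = xs"
  by (erule split_at_adjacent) (simp add: adj_swap_append)

lemma sum_adj_swap:
  assumes "\<And>xs. xs \<in> B \<Longrightarrow> Suc i < length xs" "\<And>xs. xs \<in> B \<Longrightarrow> adj_swap i xs \<in> B"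
  shows "(\<Sum>xs\<in>B. g (adj_swap i xs)) = sum g B"
  by (rule sum.reindex_bij_witness[where i = "adj_swap i" and j = "adj_swap i"])
     (use assms in \<open>auto simp: adj_swap_adj_swap\<close>)

section \<open>Inversion numbers and their signs\<close>

lemma inversions_Nil [simp]: "inversions [] = 0"
  by (simp add: inversions_def)

lemma inversions_Cons:
  "inversions (x # xs) = length (filter (\<lambda>y. y < x) xs) + inversions xs"
proof -
  let ?I = "{(i, j). i < j \<and> j < length xs \<and> xs ! i > xs ! j}"
  let ?H = "{j. j < length xs \<and> xs ! j < x}"
  have fin: "finite ?I"
    by (rule finite_subset[of _ "{..<length xs} \<times> {..<length xs}"]) auto
  have "{(i, j). i < j \<and> j < length (x # xs) \<and> (x # xs) ! i > (x # xs) ! j}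
      = (\<lambda>j. (0, Suc j)) ` ?H \<union> map_prod Suc Suc ` ?I" (is "?L = ?R")
  proof (intro equalityI subsetI)
    fix p assume "p \<in> ?L"
    then obtain i j where p: "p = (i, Suc j)" "i < Suc j" "j < length xs" "(x # xs) ! i > xs ! j"
      by (auto elim: less_natE simp: less_Suc_eq_0_disj gr0_conv_Suc)
    then show "p \<in> ?R" by (cases i) auto
  qed auto
  moreover have "card ((\<lambda>j. (0::nat, Suc j)) ` ?H \<union> map_prod Suc Suc ` ?I) = card ?H + card ?I"
    using fin by (subst card_Un_disjoint)
      (auto simp: card_image inj_on_def intro!: arg_cong2[where f = "(+)"] card_image)
  ultimately show ?thesis
    by (simp add: inversions_def length_filter_conv_card)
qed

lemma inversions_append:
  "inversions (xs @ ys) =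
     inversions xs + inversions ys + (\<Sum>x\<leftarrow>xs. length (filter (\<lambda>y. y < x) ys))"
  by (induction xs) (auto simp: inversions_Cons)

lemma inversions_snoc:
  "inversions (xs @ [y]) = inversions xs + length (filter (\<lambda>x. y < x) xs)"
  by (induction xs) (auto simp: inversions_Cons)

text \<open>The swap affects only the comparison between the two neighbouring entries. Distinctness
  makes exactly one of their two orders an inversion.\<close>

lemma sign_adj_swap:
  assumes "distinct xs" "Suc i < length xs"
  shows "(-1 :: int) ^ inversions (adj_swap i xs) = - ((-1) ^ inversions xs)"
  using assms(2,1)
  by (elim split_at_adjacent)
     (auto simp: adj_swap_append inversions_append inversions_Cons power_add
       intro!: arg_cong[where f = "\<lambda>z. (-1::int) ^ sum_list z"])

subsection \<open>The right-quantum identity\<close>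

text \<open>Here \<open>f\<close> stands for a linear functional on biwords. The case
  \<open>a = b\<close> says that two adjacent biletters with the same bottom letter commute under
  \<open>f\<close>; the general case is the cross-commutation relation of right-quantum
  matrices.\<close>

locale right_quantum =
  fixes f :: "biword \<Rightarrow> int"
  assumes right_quantum:
    "f (u @ [(x, a), (y, b)] @ v) + f (u @ [(x, b), (y, a)] @ v) =
     f (u @ [(y, a), (x, b)] @ v) + f (u @ [(y, b), (x, a)] @ v)"
begin

lemma right_quantum_adj_swap:
  assumes "length xs = length as" "Suc i < length xs"
  shows "f (zip xs as) + f (zip xs (adj_swap i as)) =
         f (zip (adj_swap i xs) as) + f (zip (adj_swap i xs) (adj_swap i as))"
proof -
  obtain us x y vs where xs: "xs = us @ x # y # vs" "length us = i"
    using assms(2) by (rule split_at_adjacent)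
  obtain bs a b cs where as: "as = bs @ a # b # cs" "length bs = i"
    using assms by (metis split_at_adjacent)
  show ?thesis
    using right_quantum[of "zip us bs" x a y b "zip vs cs"] xs as
    by (simp add: adj_swap_append)
qed

section \<open>Signed sums over the top row\<close>

text \<open>For \<open>q = []\<close> and \<open>length as = card K\<close> this is \<open>f\<close>
  applied to a noncommutative determinant with top letters from \<open>K\<close>. The list
  \<open>q\<close> is the top row of a further factor to its right.\<close>

definition alt_sum :: "nat set \<Rightarrow> nat list \<Rightarrow> nat list \<Rightarrow> int" where
  "alt_sum K q as = (\<Sum>p\<in>permutations_of_set K. (-1) ^ inversions p * f (zip (p @ q) as))"

text \<open>By the right-quantum identity the unsigned part of \<open>g\<close> is invariant under
  swapping positions \<open>i\<close> and \<open>Suc i\<close> of \<open>p\<close>, while the sign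
  flips. As the swap permutes the index set, the total equals its negative and is zero. The bound
  \<open>Suc i < card K\<close> keeps both positions below the alternating part.\<close>

lemma alt_sum_adj_swap:
  assumes "Suc i < card K" "card K + length q = length as"
  shows "alt_sum K q (adj_swap i as) = - alt_sum K q as"
proof -
  define g where "g p = (-1) ^ inversions p * (f (zip (p @ q) as) + f (zip (p @ q) (adj_swap i as)))"
    for p
  have p: "distinct p \<and> set p = K \<and> Suc i < length p \<and> length p = card K"
    if "p \<in> permutations_of_set K" for p
    using that assms by (auto simp: permutations_of_set_def distinct_card)
  have "adj_swap i p \<in> permutations_of_set K" if "p \<in> permutations_of_set K" for p
    using p[OF that] mset_adj_swap[of i p]
    by (metis mset_eq_imp_distinct_iff mset_eq_setD permutations_of_setI)
  then have "(\<Sum>p\<in>permutations_of_set K. g (adj_swap i p)) = sum g (permutations_of_set K)"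
    using p by (intro sum_adj_swap) blast+
  moreover have "g (adj_swap i p) = - g p" if "p \<in> permutations_of_set K" for p
  proof -
    have "adj_swap i (p @ q) = adj_swap i p @ q"
      using p[OF that] by (auto simp: adj_swap_def list_update_append nth_append)
    then show ?thesis
      using right_quantum_adj_swap[of "p @ q" as i] p[OF that] assms
      by (simp add: g_def sign_adj_swap)
  qed
  ultimately have "sum g (permutations_of_set K) = 0"
    by (simp add: sum_negf)
  then show ?thesis
    by (simp add: g_def alt_sum_def distrib_left sum.distrib)
qed

text \<open>Every letter of \<open>v\<close> that \<open>a\<close> passes costs one sign. The first
  hypothesis keeps all these positions below the alternating part.\<close>

lemma alt_sum_move:
  assumes "length u + length v < card K" "card K + length q = length u + Suc (length v) + length w"
  shows "alt_sum K q (u @ a # v @ w) = (-1) ^ length v * alt_sum K q (u @ v @ a # w)"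
  using assms
proof (induction v arbitrary: u)
  case (Cons b v)
  have "alt_sum K q (u @ b # a # v @ w) = - alt_sum K q (u @ a # b # v @ w)"
    using alt_sum_adj_swap[of "length u" K q "u @ a # b # v @ w"] Cons.prems
    by (simp add: adj_swap_append)
  moreover have "alt_sum K q ((u @ [b]) @ a # v @ w)
      = (-1) ^ length v * alt_sum K q ((u @ [b]) @ v @ a # w)"
    by (rule Cons.IH) (use Cons.prems in auto)
  ultimately show ?case by simp
qed simp

text \<open>The two copies of \<open>a\<close> are brought next to each other; swapping them changes
  nothing but negates the value.\<close>

lemma alt_sum_repeated:
  assumes "a \<in> set u" "length u < card K" "card K + length q = Suc (length u) + length w"
  shows "alt_sum K q (u @ a # w) = 0"
proof -
  obtain u1 u2 where u: "u = u1 @ a # u2" using assms(1) by (meson split_list)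
  have "alt_sum K q (u1 @ a # u2 @ a # w) = (-1) ^ length u2 * alt_sum K q (u1 @ u2 @ a # a # w)"
    using assms u by (intro alt_sum_move) auto
  moreover have "alt_sum K q (u1 @ u2 @ a # a # w) = - alt_sum K q (u1 @ u2 @ a # a # w)"
    using alt_sum_adj_swap[of "length (u1 @ u2)" K q "u1 @ u2 @ a # a # w"] assms u
      adj_swap_append[of "u1 @ u2" _ a a w]
    by simp
  ultimately show ?thesis unfolding u by simp
qed

section \<open>Sums over the rearrangements of the bottom row\<close>

text \<open>The right-quantum identity is summed over \<open>w\<close>. Swapping is a bijection on
  the rearrangements of \<open>c\<close>, so the two terms on each side have equal sums, and the
  factor 2 cancels in the integers.\<close>

lemma sum_bottom_adj_swap:
  assumes "length p = length u" "length q = size c" "Suc i < length q"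
  shows "(\<Sum>w\<in>permutations_of_multiset c. f (zip (p @ adj_swap i q) (u @ w))) =
         (\<Sum>w\<in>permutations_of_multiset c. f (zip (p @ q) (u @ w)))"
proof -
  let ?S = "\<lambda>q. \<Sum>w\<in>permutations_of_multiset c. f (zip (p @ q) (u @ w))"
  have len: "length w = size c" if "w \<in> permutations_of_multiset c" for w
    using that by (auto simp: permutations_of_multiset_def)
  have swap: "(\<Sum>w\<in>permutations_of_multiset c. g (adj_swap i w)) = sum g (permutations_of_multiset c)"
    for g :: "nat list \<Rightarrow> int"
    using assms by (intro sum_adj_swap) (auto simp: permutations_of_multiset_def mset_adj_swap)
  have shift: "adj_swap (length u + i) (xs @ q') = xs @ adj_swap i q'"
    if "length xs = length u" for xs q' :: "nat list"
    using that by (auto simp: adj_swap_def list_update_append nth_append)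
  have "f (zip (p @ q) (u @ w)) + f (zip (p @ q) (u @ adj_swap i w)) =
      f (zip (p @ adj_swap i q) (u @ w)) + f (zip (p @ adj_swap i q) (u @ adj_swap i w))"
    if "w \<in> permutations_of_multiset c" for w
    using right_quantum_adj_swap[of "p @ q" "u @ w" "length u + i"] assms len[OF that]
    by (simp add: shift)
  then have "?S q + (\<Sum>w\<in>permutations_of_multiset c. f (zip (p @ q) (u @ adj_swap i w))) =
      ?S (adj_swap i q) +
      (\<Sum>w\<in>permutations_of_multiset c. f (zip (p @ adj_swap i q) (u @ adj_swap i w)))"
    unfolding sum.distrib[symmetric] by (rule sum.cong[OF refl])
  then have "?S q + ?S q = ?S (adj_swap i q) + ?S (adj_swap i q)"
    unfolding swap[of "\<lambda>w. f (zip (p @ q) (u @ w))"]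
      swap[of "\<lambda>w. f (zip (p @ adj_swap i q) (u @ w))"] .
  then show ?thesis by linarith
qed

lemma sum_bottom_move:
  assumes "length p = length u" "length (q1 @ x # q2 @ q3) = size c"
  shows "(\<Sum>w\<in>permutations_of_multiset c. f (zip (p @ q1 @ x # q2 @ q3) (u @ w))) =
         (\<Sum>w\<in>permutations_of_multiset c. f (zip (p @ q1 @ q2 @ x # q3) (u @ w)))"
  using assms(2)
proof (induction q2 arbitrary: q1)
  case (Cons y q2)
  have "(\<Sum>w\<in>permutations_of_multiset c. f (zip (p @ q1 @ y # x # q2 @ q3) (u @ w))) =
        (\<Sum>w\<in>permutations_of_multiset c. f (zip (p @ q1 @ x # y # q2 @ q3) (u @ w)))"
    using sum_bottom_adj_swap[of p u "q1 @ x # y # q2 @ q3" c "length q1"] assms(1) Cons.prems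
    by (simp add: adj_swap_append)
  with Cons.IH[of "q1 @ [y]"] Cons.prems show ?case by simp
qed simp

text \<open>Induction on \<open>q\<close>: its first letter is brought to the front of
  \<open>q'\<close> and then frozen by appending it to \<open>q0\<close>.\<close>

lemma sum_bottom_cong_mset:
  assumes "length p = length u" "length (q0 @ q) = size c" "mset q = mset q'"
  shows "(\<Sum>w\<in>permutations_of_multiset c. f (zip (p @ q0 @ q) (u @ w))) =
         (\<Sum>w\<in>permutations_of_multiset c. f (zip (p @ q0 @ q') (u @ w)))"
  using assms(2,3)
proof (induction q arbitrary: q0 q')
  case (Cons x q)
  from Cons.prems obtain q1 q2 where q': "q' = q1 @ x # q2"
    by (metis list.set_intros(1) mset_eq_setD split_list)
  have len: "length q = length (q1 @ q2)"
    using arg_cong[OF Cons.prems(2), of size] q' by simp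
  have "(\<Sum>w\<in>permutations_of_multiset c. f (zip (p @ (q0 @ [x]) @ q) (u @ w))) =
        (\<Sum>w\<in>permutations_of_multiset c. f (zip (p @ (q0 @ [x]) @ q1 @ q2) (u @ w)))"
    using Cons.prems q' by (intro Cons.IH) auto
  with sum_bottom_move[of p u q0 x q1 q2 c] assms(1) Cons.prems len q' show ?case by simp
qed auto

text \<open>\<open>B\<close> is a union of full rearrangement classes. On one class
  \<open>g w\<close> and \<open>h w\<close> are constant and are rearrangements of each other, so
  the symmetry in the top row applies class by class.\<close>

lemma sum_words_cong_mset:
  assumes "finite B" "length p = length u"
    and closed: "\<And>w w'. w \<in> B \<Longrightarrow> mset w' = mset w \<Longrightarrow> w' \<in> B"
    and gh: "\<And>w. w \<in> B \<Longrightarrow> mset (g w) = mset (h w)" "\<And>w. w \<in> B \<Longrightarrow> length (g w) = length w"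
    and cong: "\<And>w w'. mset w = mset w' \<Longrightarrow> g w = g w'" "\<And>w w'. mset w = mset w' \<Longrightarrow> h w = h w'"
  shows "(\<Sum>w\<in>B. f (zip (p @ g w) (u @ w))) = (\<Sum>w\<in>B. f (zip (p @ h w) (u @ w)))"
proof -
  have "(\<Sum>w\<in>B. f (zip (p @ k w) (u @ w))) =
      (\<Sum>c\<in>mset ` B. \<Sum>w | w \<in> B \<and> mset w = c. f (zip (p @ k w) (u @ w)))" for k
    using assms(1) by (subst sum.group[where g = mset]) auto
  moreover have "(\<Sum>w | w \<in> B \<and> mset w = c. f (zip (p @ g w) (u @ w))) =
      (\<Sum>w | w \<in> B \<and> mset w = c. f (zip (p @ h w) (u @ w)))" if "c \<in> mset ` B" for c
  proof -
    from \<open>c \<in> mset ` B\<close> obtain w0 where w0: "w0 \<in> B" "c = mset w0" by blast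
    have B: "{w. w \<in> B \<and> mset w = c} = permutations_of_multiset c"
      using w0 closed by (auto simp: permutations_of_multiset_def)
    have eq: "(\<Sum>w\<in>permutations_of_multiset c. f (zip (p @ k w) (u @ w))) =
        (\<Sum>w\<in>permutations_of_multiset c. f (zip (p @ k w0) (u @ w)))"
      if "\<And>w w'. mset w = mset w' \<Longrightarrow> k w = k w'" for k :: "nat list \<Rightarrow> nat list"
    proof (rule sum.cong)
      fix w assume "w \<in> permutations_of_multiset c"
      then have "k w = k w0"
        using w0 by (intro that) (simp add: permutations_of_multiset_def)
      then show "f (zip (p @ k w) (u @ w)) = f (zip (p @ k w0) (u @ w))" by simp
    qed simp
    have "(\<Sum>w\<in>permutations_of_multiset c. f (zip (p @ g w) (u @ w))) =
        (\<Sum>w\<in>permutations_of_multiset c. f (zip (p @ g w0) (u @ w)))"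
      by (rule eq) (rule cong(1))
    also have "\<dots> = (\<Sum>w\<in>permutations_of_multiset c. f (zip (p @ h w0) (u @ w)))"
      using sum_bottom_cong_mset[of p u "[]" "g w0" c "h w0"] assms(2) gh[OF w0(1)] w0(2) by simp
    also have "\<dots> = (\<Sum>w\<in>permutations_of_multiset c. f (zip (p @ h w) (u @ w)))"
      by (rule eq[symmetric]) (rule cong(2))
    finally show ?thesis unfolding B .
  qed
  ultimately show ?thesis by (simp only: cong: sum.cong)
qed

text \<open>The symmetry is applied for each fixed \<open>p\<close> after exchanging the two sums;
  \<open>card K = length u\<close> places the alternating part exactly above
  \<open>u\<close>.\<close>

lemma sum_alt_sum_cong_mset:
  assumes "finite B" "card K = length u"
    and closed: "\<And>w w'. w \<in> B \<Longrightarrow> mset w' = mset w \<Longrightarrow> w' \<in> B"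
    and gh: "\<And>w. w \<in> B \<Longrightarrow> mset (g w) = mset (h w)" "\<And>w. w \<in> B \<Longrightarrow> length (g w) = length w"
    and cong: "\<And>w w'. mset w = mset w' \<Longrightarrow> g w = g w'" "\<And>w w'. mset w = mset w' \<Longrightarrow> h w = h w'"
  shows "(\<Sum>w\<in>B. alt_sum K (g w) (u @ w)) = (\<Sum>w\<in>B. alt_sum K (h w) (u @ w))"
proof -
  have "(\<Sum>w\<in>B. f (zip (p @ g w) (u @ w))) = (\<Sum>w\<in>B. f (zip (p @ h w) (u @ w)))"
    if "p \<in> permutations_of_set K" for p
  proof (rule sum_words_cong_mset)
    show "length p = length u"
      using that assms(2) by (auto simp: permutations_of_set_def distinct_card)
  qed (use assms in blast)+
  moreover have "(\<Sum>w\<in>B. alt_sum K (k w) (u @ w)) =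
      (\<Sum>p\<in>permutations_of_set K. (-1) ^ inversions p * (\<Sum>w\<in>B. f (zip (p @ k w) (u @ w))))" for k
    unfolding alt_sum_def by (subst sum.swap) (simp only: sum_distrib_left)
  ultimately show ?thesis by (simp only: cong: sum.cong)
qed

end

subsection \<open>Cancellation in the Koszul complex\<close>

lemma sort_butlast_Max:
  assumes "w \<noteq> []"
  shows "sort w = butlast (sort w) @ [Max (set w)]"
proof -
  have ne: "sort w \<noteq> []" using assms by (metis set_empty set_sort)
  then have eq: "sort w = butlast (sort w) @ [last (sort w)]" by simp
  have "x \<le> last (sort w)" if "x \<in> set w" for x
  proof -
    have "sorted (butlast (sort w) @ [last (sort w)])" using eq by (metis sorted_sort)
    moreover have "x \<in> set (butlast (sort w) @ [last (sort w)])" using that eq by (metis set_sort)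
    ultimately show ?thesis by (auto simp: sorted_append)
  qed
  moreover have "last (sort w) \<in> set w" using ne by (metis last_in_set set_sort)
  ultimately have "Max (set w) = last (sort w)" by (intro Max_eqI) auto
  with eq show ?thesis by metis
qed

lemma mset_butlast_sort:
  assumes "w \<noteq> []"
  shows "mset (butlast (sort w)) = mset w - {#Max (set w)#}"
  using arg_cong[OF sort_butlast_Max[OF assms], of mset] by simp

lemma sort_Cons_upper:
  assumes "\<forall>x\<in>set w. x \<le> M"
  shows "sort (M # w) = sort w @ [M]"
  by (rule properties_for_sort) (use assms in \<open>auto simp: sorted_append\<close>)

lemma sorted_list_of_set_insert_upper:
  assumes "finite P" "\<forall>j\<in>P. j < (M::nat)"
  shows "sorted_list_of_set (insert M P) = sorted_list_of_set P @ [M]"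
  using assms by (subst sorted_list_of_set_unique[symmetric]) (auto simp: sorted_wrt_append)

text \<open>The length of \<open>v\<close> counts the adjacent swaps that carry \<open>i\<close> to
  the end of the list; it will cancel the sign exponent of a Laplace expansion.\<close>

lemma sorted_list_of_set_split:
  assumes "finite P" "(i::nat) \<in> P"
  obtains u v where "sorted_list_of_set P = u @ i # v" "sorted_list_of_set (P - {i}) = u @ v"
    "length v = card {j \<in> P. i < j}"
proof -
  obtain u v where uv: "sorted_list_of_set P = u @ i # v"
    using assms by (metis set_sorted_list_of_set split_list)
  have P: "P = insert i (set u \<union> set v)"
    using arg_cong[OF uv, of set] assms(1) by simp
  have dist: "distinct (u @ i # v)" using uv by (metis distinct_sorted_list_of_set)
  have "sorted (u @ i # v)" using uv by (metis sorted_sorted_list_of_set)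
  with dist have lt: "\<forall>j\<in>set u. j < i" "\<forall>j\<in>set v. i < j" and "sorted_wrt (<) (u @ v)"
    by (auto simp: strict_sorted_iff sorted_append order_less_le)
  moreover have Pi: "P - {i} = set (u @ v)" using P lt by auto
  ultimately have "sorted_list_of_set (P - {i}) = u @ v"
    by (simp only: Pi) (metis strict_sorted_iff sorted_list_of_set.idem_if_sorted_distinct)
  moreover have "{j \<in> P. i < j} = set v" using P lt by auto
  then have "length v = card {j \<in> P. i < j}" using dist by (simp add: distinct_card)
  ultimately show ?thesis using uv by (intro that)
qed

lemma sum_permutations_of_set_snoc:
  assumes "K \<noteq> {}" "finite K"
  shows "sum g (permutations_of_set K) =
         (\<Sum>i\<in>K. \<Sum>p\<in>permutations_of_set (K - {i}). g (p @ [i]))"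
proof -
  have "sum g (permutations_of_set K) =
      (\<Sum>(i, p)\<in>(SIGMA i:K. permutations_of_set (K - {i})). g (p @ [i]))"
  proof (rule sum.reindex_bij_witness[where i = "\<lambda>(i, p). p @ [i]" and j = "\<lambda>p. (last p, butlast p)"])
    fix p assume p: "p \<in> permutations_of_set K"
    then have ne: "p \<noteq> []" using assms by (auto simp: permutations_of_set_def)
    then have eq: "p = butlast p @ [last p]" by simp
    have "set p = K" "distinct p" using p by (auto simp: permutations_of_set_def)
    then have "set (butlast p @ [last p]) = K" "distinct (butlast p @ [last p])"
      unfolding eq[symmetric] .
    then show "(last p, butlast p) \<in> (SIGMA i:K. permutations_of_set (K - {i}))"
      by (auto simp: permutations_of_set_def)
    show "(case (last p, butlast p) of (i, p) \<Rightarrow> p @ [i]) = p"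
      and "(case (last p, butlast p) of (i, p) \<Rightarrow> g (p @ [i])) = g p" using ne by auto
  next
    fix c assume "c \<in> (SIGMA i:K. permutations_of_set (K - {i}))"
    then obtain i p where c: "c = (i, p)" "i \<in> K" "set p = K - {i}" "distinct p"
      by (auto simp: permutations_of_set_def)
    then have "i \<notin> set p" "set (p @ [i]) = K" by auto
    with c(1,4) show "(case c of (i, p) \<Rightarrow> p @ [i]) \<in> permutations_of_set K"
      by (simp add: permutations_of_set_def)
    show "(last (case c of (i, p) \<Rightarrow> p @ [i]), butlast (case c of (i, p) \<Rightarrow> p @ [i])) = c"
      using c(1) by simp
  qed
  then show ?thesis using assms(2) by (subst sum.Sigma) auto
qed

lemma sum_Sigma_cong:
  assumes "finite I" "\<And>c. c \<in> I \<Longrightarrow> finite (B c)"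
    and "\<And>c. c \<in> I \<Longrightarrow> sum (g c) (B c) = sum (h c) (B c)"
  shows "(\<Sum>(c, w)\<in>Sigma I B. g c w) = (\<Sum>(c, w)\<in>Sigma I B. h c w)"
  using assms by (simp flip: sum.Sigma)

section \<open>The Koszul complex: indices, matrix coefficients and cancellation\<close>

text \<open>\<open>J\<close> stands for a basis element of an exterior power. A basis monomial of
  the symmetric power is represented by all its rearrangements \<open>w\<close>, since its
  coefficients are sums over these words.\<close>

definition koszul_index :: "nat set \<Rightarrow> nat \<Rightarrow> (nat set \<times> nat list) set" where
  "koszul_index A n = {(J, w). J \<subseteq> A \<and> w \<in> lists A \<and> card J + length w = n}"

text \<open>The inequality is strict so that a maximum common to \<open>P\<close> and
  \<open>w\<close> is credited to \<open>P\<close>.\<close>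

definition max_in_word :: "nat set \<Rightarrow> nat list \<Rightarrow> bool" where
  "max_in_word P w \<longleftrightarrow> w \<noteq> [] \<and> (\<forall>j\<in>P. j < Max (set w))"

lemma max_in_word_cong_mset: "mset w = mset w' \<Longrightarrow> max_in_word P w \<longleftrightarrow> max_in_word P w'"
  by (metis max_in_word_def mset_eq_setD set_empty)

lemma finite_koszul_index: "finite A \<Longrightarrow> finite (koszul_index A n)"
  by (rule finite_subset[of _ "Pow A \<times> {w. set w \<subseteq> A \<and> length w \<le> n}"])
     (auto simp: koszul_index_def finite_lists_length_le)

context right_quantum
begin

text \<open>Laplace expansion along the last top letter: \<open>i\<close> in last place forms an
  inversion with each larger element of \<open>K\<close>.\<close>

lemma alt_sum_expand_last:
  assumes "K \<noteq> {}" "finite K"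
  shows "alt_sum K q as = (\<Sum>i\<in>K. (-1) ^ card {j \<in> K. i < j} * alt_sum (K - {i}) (i # q) as)"
proof -
  have "inversions (p @ [i]) = card {j \<in> K. i < j} + inversions p"
    if "p \<in> permutations_of_set (K - {i})" for p i
  proof -
    have "card {j \<in> K. i < j} = card (set p \<inter> {j. i < j})"
      using that by (intro arg_cong[where f = card]) (auto simp: permutations_of_set_def)
    then show ?thesis
      using that by (simp add: inversions_snoc distinct_length_filter permutations_of_set_def Int_commute)
  qed
  then show ?thesis
    unfolding alt_sum_def sum_permutations_of_set_snoc[OF assms] sum_distrib_left
    by (intro sum.cong refl) (simp add: power_add mult.assoc)
qed

text \<open>The matrix coefficient, at a basis element \<open>(P, w)\<close> with \<open>M = Max w\<close> exceeding \<open>P\<close>, of the Koszul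
  differential composed with the coaction on the basis element obtained by moving \<open>M\<close> from \<open>w\<close>
  to \<open>P\<close>. Expanding it by the last top letter of the alternating part, or by the first letter of
  \<open>w\<close>, gives the two sides of the statement that the differential commutes with the coaction.\<close>

definition mixed_term :: "nat set \<Rightarrow> nat list \<Rightarrow> int" where
  "mixed_term P w =
     alt_sum (insert (Max (set w)) P) (butlast (sort w)) (sorted_list_of_set P @ w)"

text \<open>In the expansion by the last top letter, \<open>i = M\<close> has sign +1 because
  nothing in \<open>P\<close> exceeds \<open>M\<close>. For \<open>i \<in> P\<close> the sign has
  exponent 1, due to \<open>M\<close>, plus the number of larger elements of \<open>P\<close>. The
  latter part cancels when \<open>i\<close> is carried to the end of the sorted list in the bottom
  row, which leaves a minus sign.\<close>

lemma mixed_term_expand: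
  assumes "finite P" "max_in_word P w"
  defines "M \<equiv> Max (set w)" and "q \<equiv> butlast (sort w)"
  shows "mixed_term P w = alt_sum P (M # q) (sorted_list_of_set P @ w)
    - (\<Sum>i\<in>P. alt_sum (insert M (P - {i})) (i # q) (sorted_list_of_set (P - {i}) @ i # w))"
proof -
  have P: "\<forall>j\<in>P. j < M" "w \<noteq> []" using assms(2) by (auto simp: max_in_word_def M_def)
  then have M: "M \<notin> P" by blast
  have len: "Suc (length q) = length w" using P by (simp add: q_def)
  have "mixed_term P w = (\<Sum>i\<in>insert M P. (-1) ^ card {j \<in> insert M P. i < j} *
      alt_sum (insert M P - {i}) (i # q) (sorted_list_of_set P @ w))"
    unfolding mixed_term_def M_def[symmetric] q_def[symmetric]
    using assms(1) by (intro alt_sum_expand_last) auto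
  also have "\<dots> = (-1) ^ card {j \<in> insert M P. M < j} *
        alt_sum (insert M P - {M}) (M # q) (sorted_list_of_set P @ w) +
      (\<Sum>i\<in>P. (-1) ^ card {j \<in> insert M P. i < j} *
        alt_sum (insert M P - {i}) (i # q) (sorted_list_of_set P @ w))"
    using assms(1) M by (rule sum.insert)
  also have "{j \<in> insert M P. M < j} = {}" using P by auto
  also have "insert M P - {M} = P" using M by auto
  also have "(\<Sum>i\<in>P. (-1) ^ card {j \<in> insert M P. i < j} *
        alt_sum (insert M P - {i}) (i # q) (sorted_list_of_set P @ w)) =
      (\<Sum>i\<in>P. - alt_sum (insert M (P - {i})) (i # q) (sorted_list_of_set (P - {i}) @ i # w))"
  proof (rule sum.cong[OF refl])
    fix i assume i: "i \<in> P"
    obtain u v where uv: "sorted_list_of_set P = u @ i # v" "sorted_list_of_set (P - {i}) = u @ v"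
      "length v = card {j \<in> P. i < j}"
      using sorted_list_of_set_split[OF assms(1) i] .
    have "{j \<in> insert M P. i < j} = insert M {j \<in> P. i < j}" using P i by auto
    then have card: "card {j \<in> insert M P. i < j} = Suc (length v)"
      using assms(1) M uv by simp
    have K: "insert M P - {i} = insert M (P - {i})" using P i by auto
    have "length (u @ v) = card (P - {i})"
      using arg_cong[OF uv(2), of length] assms(1) by simp
    then have cardK: "card (insert M (P - {i})) = Suc (length (u @ v))"
      using assms(1) M by (subst card_insert_disjoint) auto
    have "alt_sum (insert M (P - {i})) (i # q) (u @ i # v @ w) =
        (-1) ^ length v * alt_sum (insert M (P - {i})) (i # q) (u @ v @ i # w)"
      by (rule alt_sum_move) (use cardK len in auto)
    then show "(-1) ^ card {j \<in> insert M P. i < j} *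
        alt_sum (insert M P - {i}) (i # q) (sorted_list_of_set P @ w) =
      - alt_sum (insert M (P - {i})) (i # q) (sorted_list_of_set (P - {i}) @ i # w)"
      unfolding card K uv(1,2) by simp
  qed
  finally show ?thesis by (simp add: sum_negf)
qed

text \<open>The alternating part is one letter longer than \<open>P\<close>, so it covers both the
  copy of \<open>j\<close> in the sorted list of \<open>P\<close> and the first letter of the
  word.\<close>

lemma mixed_term_repeated:
  assumes "finite P" "max_in_word P (j # w)" "j \<in> P"
  shows "mixed_term P (j # w) = 0"
proof -
  let ?M = "Max (set (j # w))"
  have "?M \<notin> P" using assms(2) unfolding max_in_word_def by blast
  then show ?thesis
    unfolding mixed_term_def using assms(1,3) by (intro alt_sum_repeated) auto
qed

text \<open>A maximal first letter extends the sorted list of \<open>P\<close> to that of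
  \<open>insert M P\<close>, so the mixed term becomes the diagonal coefficient at
  \<open>(insert M P, w)\<close>.\<close>

lemma mixed_term_max:
  assumes "finite P" "\<forall>j\<in>P. j < M" "\<forall>x\<in>set w. x \<le> M"
  shows "mixed_term P (M # w) =
    alt_sum (insert M P) (sort w) (sorted_list_of_set (insert M P) @ w)"
proof -
  have "Max (set (M # w)) = M" using assms(3) by (intro Max_eqI) auto
  then show ?thesis
    unfolding mixed_term_def sort_Cons_upper[OF assms(3)]
      sorted_list_of_set_insert_upper[OF assms(1,2)] by simp
qed

text \<open>Double evaluation of \<open>sum R W\<close>, the signed total of the mixed terms. By the
  first letter of the word it is \<open>sum Y X - sum T U\<close>; by the last letter of the
  alternating part it is \<open>sum Z X + sum T W\<close>. Since \<open>sum Y X = sum Z X\<close>,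
  the two diagonal totals add up to zero.\<close>

lemma alternating_sum_eq_0:
  assumes A: "finite A" and n: "n > 0"
  shows "(\<Sum>(J, w)\<in>koszul_index A n.
           (-1) ^ card J * alt_sum J (sort w) (sorted_list_of_set J @ w)) = 0"
proof -
  \<comment> \<open>\<open>T\<close> is the diagonal coefficient. \<open>W\<close> and \<open>U\<close> are the indices whose maximum lies only in the word
    and in the set, respectively. \<open>Y\<close> and \<open>Z\<close> are the off-diagonal terms of the two expansions.\<close>
  define T where "T = (\<lambda>(J, w). (-1) ^ card J * alt_sum J (sort w) (sorted_list_of_set J @ w))"
  define R where "R = (\<lambda>(P, w). (-1) ^ card P * mixed_term P w)"
  define W where "W = {(P, w) \<in> koszul_index A n. max_in_word P w}"
  define U where "U = koszul_index A n - W"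
  define C where "C = {(P, j). P \<subseteq> A \<and> j \<in> A \<and> j \<notin> P}"
  define X where "X = Sigma C (\<lambda>(P, j). {w. (insert j P, w) \<in> W})"
  define Y where "Y = (\<lambda>((P, j), w). (-1) ^ card P * mixed_term P (j # w))"
  define Z where "Z = (\<lambda>((P, j), w). (-1) ^ card P *
    alt_sum (insert (Max (set w)) P) (j # butlast (sort w)) (sorted_list_of_set P @ j # w))"
  have fin_idx: "finite (koszul_index A n)" using A by (rule finite_koszul_index)
  then have finW: "finite W" by (rule rev_finite_subset) (auto simp: W_def)
  have finP: "finite P" if "P \<subseteq> A" for P using that A by (rule finite_subset)
  have finC: "finite C"
    by (rule finite_subset[of _ "Pow A \<times> A"]) (use A in \<open>auto simp: C_def\<close>)
  have fin_slice: "finite {w. (P, w) \<in> W}" for P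
    by (rule finite_subset[of _ "snd ` W"]) (use finW in force)+
  have slice_mset: "(P, w') \<in> W" if "(P, w) \<in> W" "mset w' = mset w" for P w w'
    using that max_in_word_cong_mset[OF that(2)] mset_eq_setD[OF that(2)] mset_eq_length[OF that(2)]
    by (auto simp: W_def koszul_index_def)
  have WD: "P \<subseteq> A" "finite P" "max_in_word P w" "w \<noteq> []" "\<forall>j\<in>P. j < Max (set w)"
      "Max (set w) \<notin> P" "set w \<subseteq> A" "card P + length w = n"
    if "(P, w) \<in> W" for P w
    using that finP by (auto simp: W_def koszul_index_def max_in_word_def)
  \<comment> \<open>A first letter below the maximum can be moved into the set without changing the
    degree or the place of the maximum. This identifies \<open>X\<close> with the indices in
    \<open>W\<close> whose first letter is neither maximal nor in \<open>P\<close>.\<close>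
  have W_Cons_iff: "(P, j # w) \<in> W \<and> j \<noteq> Max (set (j # w)) \<longleftrightarrow> (insert j P, w) \<in> W"
    if "j \<notin> P" for P j w
  proof -
    have "max_in_word P (j # w) \<and> j \<noteq> Max (set (j # w)) \<longleftrightarrow> max_in_word (insert j P) w"
      by (cases "w = []") (auto simp: max_in_word_def max_def)
    moreover have "(P, j # w) \<in> koszul_index A n \<longleftrightarrow> (insert j P, w) \<in> koszul_index A n"
      using that finP[of P] by (auto simp: koszul_index_def)
    ultimately show ?thesis unfolding W_def by blast
  qed

  \<comment> \<open>Three cases for the first letter of the word: in \<open>P\<close> it gives zero,
    maximal (\<open>W1\<close>) it gives a diagonal term, otherwise (\<open>W2\<close>) it gives a
    term of \<open>Y\<close>.\<close>
  have first: "sum R W = sum Y X - sum T U"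
  proof -
    define W1 where "W1 = {(P, w) \<in> W. hd w = Max (set w)}"
    define W2 where "W2 = {(P, w) \<in> W. hd w \<noteq> Max (set w) \<and> hd w \<notin> P}"
    have "sum R W = sum R (W1 \<union> W2)"
    proof (rule sum.mono_neutral_right)
      show "\<forall>c\<in>W - (W1 \<union> W2). R c = 0"
      proof
        fix c assume c: "c \<in> W - (W1 \<union> W2)"
        obtain P w where [simp]: "c = (P, w)" by (cases c)
        have "(P, w) \<in> W" "hd w \<in> P" using c by (auto simp: W1_def W2_def)
        then show "R c = 0"
          using WD[of P w] mixed_term_repeated[of P "hd w" "tl w"] by (simp add: R_def)
      qed
    qed (use finW in \<open>auto simp: W1_def W2_def\<close>)
    also have "\<dots> = sum R W1 + sum R W2"
      by (rule sum.union_disjoint)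
        (auto simp: W1_def W2_def intro: rev_finite_subset[OF finW])
    also have "sum R W2 = sum Y X"
    proof (rule sum.reindex_bij_witness[where i = "\<lambda>c. (fst (fst c), snd (fst c) # snd c)"
          and j = "\<lambda>c. ((fst c, hd (snd c)), tl (snd c))"])
      fix c assume c: "c \<in> W2"
      obtain P w where [simp]: "c = (P, w)" by (cases c)
      have w: "(P, w) \<in> W" "hd w \<noteq> Max (set w)" "hd w \<notin> P" using c by (auto simp: W2_def)
      note W = WD[OF w(1)]
      have eq: "hd w # tl w = w" using W(4) by simp
      then show "(fst (fst ((fst c, hd (snd c)), tl (snd c))),
          snd (fst ((fst c, hd (snd c)), tl (snd c))) # snd ((fst c, hd (snd c)), tl (snd c))) = c"
        by simp
      show "Y ((fst c, hd (snd c)), tl (snd c)) = R c"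
        using eq by (simp add: Y_def R_def)
      have "(insert (hd w) P, tl w) \<in> W"
        using W_Cons_iff[OF w(3), of "tl w"] w eq by simp
      moreover have "hd w \<in> A" using W(4,7) by (metis hd_in_set subsetD)
      ultimately show "((fst c, hd (snd c)), tl (snd c)) \<in> X"
        using W w by (simp add: X_def C_def)
    next
      fix c assume "c \<in> X"
      then obtain P j w where [simp]: "c = ((P, j), w)" and "j \<notin> P" "(insert j P, w) \<in> W"
        by (auto simp: X_def C_def)
      then show "(fst (fst c), snd (fst c) # snd c) \<in> W2"
        using W_Cons_iff[of j P w] by (auto simp: W2_def)
    qed auto
    \<comment> \<open>Moving the maximal first letter into the set is a bijection from
      \<open>W1\<close> to \<open>U\<close>; the set grows by one element, hence the sign.\<close>
    also have "sum R W1 = (\<Sum>c\<in>U. - T c)"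
    proof (rule sum.reindex_bij_witness[where i = "\<lambda>(J, w). (J - {Max J}, Max J # w)"
          and j = "\<lambda>(P, w). (insert (hd w) P, tl w)"])
      fix c assume c: "c \<in> W1"
      obtain P w where Pw: "c = (P, w)" by (cases c)
      have w: "(P, w) \<in> W" "hd w = Max (set w)" using c Pw by (auto simp: W1_def)
      note W = WD[OF w(1)]
      obtain M v where [simp]: "w = M # v" using W(4) by (cases w) auto
      have M: "Max (insert M (set v)) = M" using w(2) by simp
      then have P: "\<forall>j\<in>P. j < M" "\<forall>x\<in>set v. x \<le> M" "M \<notin> P"
        using W(5,6) by (auto, metis List.finite_set Max_ge finite_insert insertI2)
      have MaxJ: "Max (insert M P) = M" using W(2) P by (intro Max_eqI) (auto simp: less_imp_le)
      show "(case case c of (P, w) \<Rightarrow> (insert (hd w) P, tl w) of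
          (J, w) \<Rightarrow> (J - {Max J}, Max J # w)) = c"
        using Pw MaxJ P(3) by simp
      show "- T (case c of (P, w) \<Rightarrow> (insert (hd w) P, tl w)) = R c"
        using Pw P(3) W(2) mixed_term_max[OF W(2) P(1,2)] by (simp add: T_def R_def)
      have "\<not> max_in_word (insert M P) v"
        using P(2) by (auto simp: max_in_word_def not_less)
      then show "(case c of (P, w) \<Rightarrow> (insert (hd w) P, tl w)) \<in> U"
        using Pw P(3) W(1,2,7,8) by (auto simp: U_def W_def koszul_index_def)
    next
      fix c assume c: "c \<in> U"
      obtain J w where [simp]: "c = (J, w)" by (cases c)
      have J: "(J, w) \<in> koszul_index A n" "\<not> max_in_word J w" using c by (auto simp: U_def W_def)
      then have "J \<subseteq> A" "set w \<subseteq> A" "card J + length w = n" by (auto simp: koszul_index_def)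
      \<comment> \<open>Positive degree enters here: for empty \<open>J\<close> the word would be
        nonempty and the index would belong to \<open>W\<close>.\<close>
      moreover have "J \<noteq> {}" using J(2) n calculation(3) by (auto simp: max_in_word_def)
      moreover have "finite J" using finP calculation(1) .
      ultimately obtain M where M: "M \<in> J" "M = Max J" "\<forall>j\<in>J. j \<le> M"
        by (metis Max_ge Max_in)
      have "card J = Suc (card (J - {M}))" using M(1) \<open>finite J\<close> by (metis card_Suc_Diff1)
      then have "card (J - {M}) + length (M # w) = n"
        using \<open>card J + length w = n\<close> by (simp only: list.size)
      moreover have "insert M (J - {M}) = J" "M \<in> A" "J - {M} \<subseteq> A" "\<forall>j\<in>J - {M}. j < M"
        using M(1,3) \<open>J \<subseteq> A\<close> by (auto simp: order_less_le)
      ultimately have Max: "insert (Max J) (J - {Max J}) = J" "Max J \<in> A" "J - {Max J} \<subseteq> A"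
        "card (J - {Max J}) + length (Max J # w) = n" "\<forall>j\<in>J - {Max J}. j < Max J"
        unfolding M(2) by blast+
      have "\<forall>x\<in>set w. x \<le> Max J"
      proof
        fix x assume x: "x \<in> set w"
        then have "x \<le> Max (set w)" by simp
        moreover obtain j where "j \<in> J" "Max (set w) \<le> j"
          using J(2) x by (auto simp: max_in_word_def not_less)
        ultimately show "x \<le> Max J" using \<open>finite J\<close> by (meson Max_ge order_trans)
      qed
      then have "Max (set (Max J # w)) = Max J" by (intro Max_eqI) auto
      moreover from this have "max_in_word (J - {Max J}) (Max J # w)"
        using Max(5) unfolding max_in_word_def by (simp only: list.simps) blast
      moreover have "(J - {Max J}, Max J # w) \<in> koszul_index A n"
        unfolding koszul_index_def using Max(2-4) \<open>set w \<subseteq> A\<close> by (simp add: in_lists_conv_set subset_iff)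
      ultimately show "(case c of (J, w) \<Rightarrow> (J - {Max J}, Max J # w)) \<in> W1"
        by (simp add: W1_def W_def)
      show "(case case c of (J, w) \<Rightarrow> (J - {Max J}, Max J # w) of
          (P, w) \<Rightarrow> (insert (hd w) P, tl w)) = c"
        using Max by simp
    qed
    finally show ?thesis by (simp add: sum_negf)
  qed

  \<comment> \<open>The summand for \<open>i \<in> P\<close> is indexed by
    \<open>(P - {i}, i)\<close>; removing \<open>i\<close> changes the parity of the set, which
    absorbs the minus sign of the expansion.\<close>
  have second: "sum R W = sum Z X + sum T W"
  proof -
    have "sum R W = (\<Sum>(P, w)\<in>W.
          (-1) ^ card P * alt_sum P (Max (set w) # butlast (sort w)) (sorted_list_of_set P @ w)) +
        (\<Sum>(P, w)\<in>W. \<Sum>i\<in>P. Z ((P - {i}, i), w))"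
      unfolding sum.distrib[symmetric]
    proof (rule sum.cong[OF refl], clarify)
      fix P w assume w: "(P, w) \<in> W"
      note W = WD[OF w]
      have "(-1) ^ card P * - alt_sum (insert (Max (set w)) (P - {i})) (i # butlast (sort w))
          (sorted_list_of_set (P - {i}) @ i # w) = Z ((P - {i}, i), w)" if "i \<in> P" for i
      proof -
        have "card P = Suc (card (P - {i}))" using W(2) that by (metis card_Suc_Diff1)
        then show ?thesis by (simp add: Z_def)
      qed
      then show "R (P, w) =
          (-1) ^ card P * alt_sum P (Max (set w) # butlast (sort w)) (sorted_list_of_set P @ w) +
          (\<Sum>i\<in>P. Z ((P - {i}, i), w))"
        using mixed_term_expand[OF W(2,3)]
        by (simp add: R_def right_diff_distrib sum_distrib_left flip: sum_negf)
    qed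
    also have "(\<Sum>(P, w)\<in>W. \<Sum>i\<in>P. Z ((P - {i}, i), w)) = sum Z X"
    proof -
      have "(\<Sum>(P, w)\<in>W. \<Sum>i\<in>P. Z ((P - {i}, i), w)) =
          (\<Sum>c\<in>W. \<Sum>i\<in>fst c. Z ((fst c - {i}, i), snd c))"
        by (simp add: case_prod_beta)
      also have "\<dots> = (\<Sum>(c, i)\<in>Sigma W fst. Z ((fst c - {i}, i), snd c))"
        using finW WD(2) by (intro sum.Sigma) auto
      also have "\<dots> = sum Z X"
        by (rule sum.reindex_bij_witness[where i = "\<lambda>((P, i), w). ((insert i P, w), i)"
              and j = "\<lambda>(c, i). ((fst c - {i}, i), snd c)"])
           (auto simp: X_def C_def insert_absorb dest: subsetD[OF WD(1)])
      finally show ?thesis .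
    qed
    \<comment> \<open>The top rows with the maximum in front and at the end are rearrangements of
      each other. The words over a fixed \<open>P\<close> form full rearrangement classes, so the
      sums over them agree.\<close>
    also have "(\<Sum>(P, w)\<in>W.
          (-1) ^ card P * alt_sum P (Max (set w) # butlast (sort w)) (sorted_list_of_set P @ w))
        = sum T W"
    proof -
      have W: "W = Sigma (Pow A) (\<lambda>P. {w. (P, w) \<in> W})" using WD(1) by auto
      show ?thesis
        unfolding T_def
      proof (subst (1 2) W, rule sum_Sigma_cong)
        fix P assume "P \<in> Pow A"
        then have "finite P" using finP by simp
        have "(\<Sum>w | (P, w) \<in> W.
              alt_sum P (Max (set w) # butlast (sort w)) (sorted_list_of_set P @ w)) =
            (\<Sum>w | (P, w) \<in> W. alt_sum P (sort w) (sorted_list_of_set P @ w))"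
        proof (rule sum_alt_sum_cong_mset)
          fix w w' :: "nat list" assume eq: "mset w = mset w'"
          then show "sort w = sort w'" by (metis sorted_list_of_multiset_mset)
          with mset_eq_setD[OF eq] show "Max (set w) # butlast (sort w) = Max (set w') # butlast (sort w')"
            by simp
        next
          fix w assume w: "w \<in> {w. (P, w) \<in> W}"
          then have "w \<noteq> []" using WD(4) by simp
          then show "mset (Max (set w) # butlast (sort w)) = mset (sort w)"
            "length (Max (set w) # butlast (sort w)) = length w"
            by (simp_all add: mset_butlast_sort)
        qed (use slice_mset fin_slice \<open>finite P\<close> in \<open>simp_all\<close>)
        then show "(\<Sum>w | (P, w) \<in> W. (-1) ^ card P *
              alt_sum P (Max (set w) # butlast (sort w)) (sorted_list_of_set P @ w)) =
            (\<Sum>w | (P, w) \<in> W. (-1) ^ card P * alt_sum P (sort w) (sorted_list_of_set P @ w))"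
          by (simp flip: sum_distrib_left)
      qed (use A fin_slice in auto)
    qed
    finally show ?thesis by simp
  qed

  \<comment> \<open>As \<open>j\<close> lies below the maximum of \<open>w\<close>, deleting the
    maximum from \<open>sort (j # w)\<close> leaves the letters of
    \<open>j # butlast (sort w)\<close>; the symmetry in the top row then compares the sums.\<close>
  have "sum Y X = sum Z X"
  proof -
    have "(\<Sum>w | (insert j P, w) \<in> W. Y ((P, j), w)) = (\<Sum>w | (insert j P, w) \<in> W. Z ((P, j), w))"
      if c: "(P, j) \<in> C" for P j
    proof -
      have P: "finite P" "j \<notin> P" using c finP by (auto simp: C_def)
      \<comment> \<open>The alternating part depends on \<open>w\<close> through its maximum,
        whereas the symmetry needs a fixed \<open>K\<close>; the words are therefore grouped by
        \<open>K\<close>. Below, \<open>j\<close> is counted with the bottom row of the alternating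
        part, whose length is then \<open>card K\<close>.\<close>
      define B where "B K = {w. (insert j P, w) \<in> W \<and> insert (Max (set w)) P = K}" for K
      let ?K = "\<lambda>w. insert (Max (set w)) P"
      have eq: "(\<Sum>w\<in>B K. alt_sum K (butlast (sort (j # w))) ((sorted_list_of_set P @ [j]) @ w)) =
          (\<Sum>w\<in>B K. alt_sum K (j # butlast (sort w)) ((sorted_list_of_set P @ [j]) @ w))" for K
      proof (cases "B K = {}")
        case False
        then obtain w0 where w0: "w0 \<in> B K" by blast
        show ?thesis
        proof (rule sum_alt_sum_cong_mset)
          show "finite (B K)"
            using fin_slice[of "insert j P"] by (rule rev_finite_subset) (auto simp: B_def)
          have "Max (set w0) \<notin> P" using WD(6)[of "insert j P" w0] w0 by (auto simp: B_def)
          then show "card K = length (sorted_list_of_set P @ [j])"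
            using P w0 by (auto simp: B_def)
        next
          fix w w' assume "w \<in> B K" "mset w' = mset w"
          then show "w' \<in> B K" using slice_mset[of _ w w'] mset_eq_setD[of w' w] by (simp add: B_def)
        next
          fix w assume "w \<in> B K"
          then have w: "w \<noteq> []" "j < Max (set w)"
            using WD(4,5)[of "insert j P" w] by (auto simp: B_def)
          have "Max (set (j # w)) = Max (set w)" using w by (simp add: max_def)
          moreover have "Max (set w) \<in># mset w" using w by simp
          ultimately show "mset (butlast (sort (j # w))) = mset (j # butlast (sort w))"
            using w mset_butlast_sort[of "j # w"] mset_butlast_sort[of w] by simp
          show "length (butlast (sort (j # w))) = length w" by simp
        next
          fix w w' :: "nat list" assume "mset w = mset w'"
          then have "sort (j # w) = sort (j # w')" "sort w = sort w'"
            by (metis mset.simps(2) sorted_list_of_multiset_mset)+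
          then show "butlast (sort (j # w)) = butlast (sort (j # w'))"
            "j # butlast (sort w) = j # butlast (sort w')" by simp_all
        qed
      qed simp
      have group: "sum g {w. (insert j P, w) \<in> W} =
          (\<Sum>K\<in>?K ` {w. (insert j P, w) \<in> W}. sum g (B K))" for g :: "nat list \<Rightarrow> int"
        using sum.group[of "{w. (insert j P, w) \<in> W}" "?K ` {w. (insert j P, w) \<in> W}" ?K g]
          fin_slice by (simp add: B_def)
      have "sum (\<lambda>w. Y ((P, j), w)) (B K) = sum (\<lambda>w. Z ((P, j), w)) (B K)" for K
      proof -
        have "sum (\<lambda>w. Y ((P, j), w)) (B K) = (-1) ^ card P *
          (\<Sum>w\<in>B K. alt_sum K (butlast (sort (j # w))) ((sorted_list_of_set P @ [j]) @ w))"
          unfolding sum_distrib_left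
        proof (rule sum.cong[OF refl])
          fix w assume w: "w \<in> B K"
          then have "Max (set (j # w)) = Max (set w)"
            using WD(4,5)[of "insert j P" w] by (auto simp: B_def max_def)
          then show "Y ((P, j), w) = (-1) ^ card P *
              alt_sum K (butlast (sort (j # w))) ((sorted_list_of_set P @ [j]) @ w)"
            using w by (simp add: Y_def mixed_term_def B_def)
        qed
        moreover have "sum (\<lambda>w. Z ((P, j), w)) (B K) = (-1) ^ card P *
          (\<Sum>w\<in>B K. alt_sum K (j # butlast (sort w)) ((sorted_list_of_set P @ [j]) @ w))"
          unfolding sum_distrib_left by (rule sum.cong[OF refl]) (auto simp: Z_def B_def)
        ultimately show ?thesis using eq by simp
      qed
      then show ?thesis unfolding group by simp
    qed
    then have "(\<Sum>(c, w)\<in>X. Y (c, w)) = (\<Sum>(c, w)\<in>X. Z (c, w))"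
      unfolding X_def using finC fin_slice by (intro sum_Sigma_cong) (auto split: prod.splits)
    then show ?thesis by simp
  qed
  moreover have "sum T (koszul_index A n) = sum T U + sum T W"
    unfolding U_def using fin_idx by (intro sum.subset_diff) (auto simp: W_def)
  ultimately show ?thesis using first second by (simp add: T_def)
qed

end

subsection \<open>Pairing with Ferm and Bos\<close>

definition biwords_of_length :: "nat \<Rightarrow> nat \<Rightarrow> biword set" where
  "biwords_of_length r n = {v \<in> biwords r. length v = n}"

definition words_of_length :: "nat \<Rightarrow> nat \<Rightarrow> nat list set" where
  "words_of_length r n = {w \<in> lists (alphabet r). length w = n}"

lemma finite_alphabet [simp]: "finite (alphabet r)"
  by (simp add: alphabet_def)

lemma finite_subset_alphabet: "J \<in> Pow (alphabet r) \<Longrightarrow> finite J"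
  by (rule finite_subset[of J "alphabet r"]) auto

lemma finite_lists_fixed_length: "finite A \<Longrightarrow> finite {w \<in> lists A. length w = n}"
  using finite_lists_length_eq[of A n] by (simp add: lists_eq_set conj_commute)

lemma finite_biwords_of_length [simp]: "finite (biwords_of_length r n)"
  unfolding biwords_of_length_def biwords_def by (simp add: finite_lists_fixed_length)

lemma finite_words_of_length [simp]: "finite (words_of_length r n)"
  unfolding words_of_length_def by (simp add: finite_lists_fixed_length)

lemma zip_in_biwords:
  "set xs \<subseteq> alphabet r \<Longrightarrow> set as \<subseteq> alphabet r \<Longrightarrow> zip xs as \<in> biwords r"
  by (auto simp: biwords_def in_lists_conv_set dest: set_zip_leftD set_zip_rightD)

lemma bij_betw_permutes_lists:
  assumes "finite J"
  shows "bij_betw (\<lambda>\<sigma>. map \<sigma> (sorted_list_of_set J)) {\<sigma>. \<sigma> permutes J}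
           (permutations_of_set (J :: nat set))"
proof -
  let ?h = "\<lambda>\<sigma>. map \<sigma> (sorted_list_of_set J)"
  have inj: "inj_on ?h {\<sigma>. \<sigma> permutes J}"
  proof (rule inj_onI, rule ext)
    fix \<sigma> \<tau> x assume *: "\<sigma> \<in> {\<sigma>. \<sigma> permutes J}" "\<tau> \<in> {\<sigma>. \<sigma> permutes J}" "?h \<sigma> = ?h \<tau>"
    show "\<sigma> x = \<tau> x"
      using * assms by (cases "x \<in> J") (auto simp: permutes_not_in)
  qed
  have "?h ` {\<sigma>. \<sigma> permutes J} \<subseteq> permutations_of_set J"
    using assms
    by (auto simp: permutations_of_set_def distinct_map permutes_image permutes_inj_on)
  moreover have "card (?h ` {\<sigma>. \<sigma> permutes J}) = card (permutations_of_set J)"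
    using assms by (simp add: card_image[OF inj] card_permutations)
  ultimately have "?h ` {\<sigma>. \<sigma> permutes J} = permutations_of_set J"
    by (intro card_subset_eq) auto
  with inj show ?thesis by (simp add: bij_betw_def)
qed

lemma Ferm_eq:
  "Ferm r u = (\<Sum>J\<in>Pow (alphabet r). (-1) ^ card J *
     (\<Sum>p\<in>permutations_of_set J. (-1) ^ inversions p * single (zip p (sorted_list_of_set J)) u))"
  unfolding Ferm_def biword_def
proof (rule sum.cong[OF refl])
  fix J assume "J \<in> Pow (alphabet r)"
  then have "finite J" by (rule finite_subset_alphabet)
  from sum.reindex_bij_betw[OF bij_betw_permutes_lists[OF this],
      of "\<lambda>p. (-1) ^ inversions p * single (zip p (sorted_list_of_set J)) u"]
  show "(-1) ^ card J * (\<Sum>\<sigma> | \<sigma> permutes J. (-1) ^ inversions (map \<sigma> (sorted_list_of_set J)) *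
        single (zip (map \<sigma> (sorted_list_of_set J)) (sorted_list_of_set J)) u) =
      (-1) ^ card J *
        (\<Sum>p\<in>permutations_of_set J. (-1) ^ inversions p * single (zip p (sorted_list_of_set J)) u)"
    by simp
qed

lemma sum_single_mult:
  assumes "finite S"
  shows "(\<Sum>u\<in>S. single a u * g u) = (if a \<in> S then g a else 0)"
proof -
  have "(\<Sum>u\<in>S. single a u * g u) = (\<Sum>u\<in>S. if u = a then g u else 0)"
    by (intro sum.cong) (auto simp: single_def)
  then show ?thesis using assms by simp
qed

text \<open>The biwords attached to \<open>J\<close> have length \<open>card J\<close>, so degree
  \<open>k\<close> selects the subsets of size \<open>k\<close>.\<close>

lemma Ferm_pairing:
  "(\<Sum>u\<in>biwords_of_length r k. Ferm r u * g u) =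
   (\<Sum>J\<in>Pow (alphabet r). if card J = k then (-1) ^ card J *
      (\<Sum>p\<in>permutations_of_set J. (-1) ^ inversions p * g (zip p (sorted_list_of_set J))) else 0)"
proof -
  let ?B = "biwords_of_length r k"
  have "(\<Sum>u\<in>?B. Ferm r u * g u) = (\<Sum>J\<in>Pow (alphabet r). \<Sum>u\<in>?B. (-1) ^ card J *
      (\<Sum>p\<in>permutations_of_set J. (-1) ^ inversions p * (single (zip p (sorted_list_of_set J)) u * g u)))"
    unfolding Ferm_eq sum_distrib_right by (subst sum.swap) (simp add: sum_distrib_right mult.assoc)
  also have "\<dots> = (\<Sum>J\<in>Pow (alphabet r). (-1) ^ card J * (\<Sum>p\<in>permutations_of_set J.
      (-1) ^ inversions p * (\<Sum>u\<in>?B. single (zip p (sorted_list_of_set J)) u * g u)))"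
    unfolding sum_distrib_left by (subst (2) sum.swap) (rule refl)
  also have "\<dots> = (\<Sum>J\<in>Pow (alphabet r). if card J = k then (-1) ^ card J *
      (\<Sum>p\<in>permutations_of_set J. (-1) ^ inversions p * g (zip p (sorted_list_of_set J))) else 0)"
  proof (rule sum.cong[OF refl])
    fix J assume J: "J \<in> Pow (alphabet r)"
    then have "finite J" by (rule finite_subset_alphabet)
    have "zip p (sorted_list_of_set J) \<in> ?B \<longleftrightarrow> card J = k" if "p \<in> permutations_of_set J" for p
    proof -
      have "length p = card J" "set p = J"
        using that by (auto simp: permutations_of_set_def distinct_card)
      then show ?thesis
        using J \<open>finite J\<close> zip_in_biwords[of p r "sorted_list_of_set J"]
        by (auto simp: biwords_of_length_def)
    qed
    then show "(-1) ^ card J * (\<Sum>p\<in>permutations_of_set J.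
        (-1) ^ inversions p * (\<Sum>u\<in>?B. single (zip p (sorted_list_of_set J)) u * g u)) =
      (if card J = k then (-1) ^ card J *
        (\<Sum>p\<in>permutations_of_set J. (-1) ^ inversions p * g (zip p (sorted_list_of_set J))) else 0)"
      by (auto simp: sum_single_mult intro!: sum.cong sum.neutral)
  qed
  finally show ?thesis .
qed

lemma Bos_pairing:
  "(\<Sum>u\<in>biwords_of_length r m. Bos r u * g u) = (\<Sum>w\<in>words_of_length r m. g (zip (sort w) w))"
proof -
  let ?B = "biwords_of_length r m"
  have "Bos r u = (\<Sum>w\<in>words_of_length r m. single (zip (sort w) w) u)" if "u \<in> ?B" for u
  proof -
    \<comment> \<open>A word contributing to \<open>u\<close> has the length of \<open>u\<close>,
      which reduces the infinite sum to a finite one.\<close>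
    have "{w \<in> lists (alphabet r). biword (sort w) w = u} =
        {w \<in> words_of_length r m. zip (sort w) w = u}"
      using that by (auto simp: words_of_length_def biwords_of_length_def biword_def)
    then show ?thesis
      unfolding Bos_def single_def by (auto simp: sum.If_cases Int_def eq_commute)
  qed
  then have "(\<Sum>u\<in>?B. Bos r u * g u) =
      (\<Sum>w\<in>words_of_length r m. \<Sum>u\<in>?B. single (zip (sort w) w) u * g u)"
    by (subst sum.swap) (simp add: sum_distrib_right)
  also have "\<dots> = (\<Sum>w\<in>words_of_length r m. g (zip (sort w) w))"
  proof (rule sum.cong[OF refl])
    fix w assume "w \<in> words_of_length r m"
    then have "zip (sort w) w \<in> ?B"
      using zip_in_biwords[of "sort w" r w]
      by (auto simp: words_of_length_def biwords_of_length_def)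
    then show "(\<Sum>u\<in>?B. single (zip (sort w) w) u * g u) = g (zip (sort w) w)"
      by (simp add: sum_single_mult)
  qed
  finally show ?thesis .
qed

section \<open>Pairing with the product\<close>

lemma series_mult_pairing:
  "(\<Sum>v\<in>biwords_of_length r n. series_mult E F v * g v) =
   (\<Sum>k\<le>n. \<Sum>u\<in>biwords_of_length r k. E u *
      (\<Sum>u'\<in>biwords_of_length r (n - k). F u' * g (u @ u')))"
proof -
  have "(\<Sum>v\<in>biwords_of_length r n. series_mult E F v * g v) =
      (\<Sum>v\<in>biwords_of_length r n. \<Sum>k\<le>n. E (take k v) * F (drop k v) * g v)"
    by (intro sum.cong) (auto simp: series_mult_def sum_distrib_right biwords_of_length_def)
  also have "\<dots> = (\<Sum>k\<le>n. \<Sum>v\<in>biwords_of_length r n. E (take k v) * F (drop k v) * g v)"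
    by (rule sum.swap)
  also have "\<dots> = (\<Sum>k\<le>n. \<Sum>(u, u')\<in>biwords_of_length r k \<times> biwords_of_length r (n - k).
      E u * F u' * g (u @ u'))"
  proof (intro sum.cong refl)
    fix k assume "k \<in> {..n}"
    then have k: "k \<le> n" by simp
    have split: "take k v \<in> biwords r \<and> drop k v \<in> biwords r" if "v \<in> biwords r" for v
      using that unfolding biwords_def by (metis append_in_lists_conv append_take_drop_id)
    show "(\<Sum>v\<in>biwords_of_length r n. E (take k v) * F (drop k v) * g v) =
        (\<Sum>(u, u')\<in>biwords_of_length r k \<times> biwords_of_length r (n - k). E u * F u' * g (u @ u'))"
      by (rule sum.reindex_bij_witness[where i = "\<lambda>(u, u'). u @ u'" and j = "\<lambda>v. (take k v, drop k v)"])
         (use k split in \<open>auto simp: biwords_of_length_def min_def biwords_def\<close>)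
  qed
  finally show ?thesis
    by (simp add: sum.cartesian_product[symmetric] sum_distrib_left mult.assoc)
qed

text \<open>Collecting the summands by \<open>(J, w)\<close> gives the alternating sum over
  \<open>koszul_index\<close>, which vanishes in positive degree. In degree 0 the only index is
  \<open>({}, [])\<close>.\<close>

lemma Ferm_Bos_pairing:
  assumes "right_quantum g"
  shows "(\<Sum>v\<in>biwords_of_length r n. series_mult (Ferm r) (Bos r) v * g v) =
         (if n = 0 then g [] else 0)"
proof -
  interpret right_quantum g by fact
  define H where "H J m = (-1) ^ card J * (\<Sum>p\<in>permutations_of_set J. (-1) ^ inversions p *
    (\<Sum>w\<in>words_of_length r m. g (zip p (sorted_list_of_set J) @ zip (sort w) w)))" for J m
  have "(\<Sum>v\<in>biwords_of_length r n. series_mult (Ferm r) (Bos r) v * g v) =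
      (\<Sum>k\<le>n. \<Sum>J\<in>Pow (alphabet r). if card J = k then H J (n - k) else 0)"
    unfolding series_mult_pairing Bos_pairing Ferm_pairing H_def ..
  also have "\<dots> = (\<Sum>J\<in>Pow (alphabet r). \<Sum>k\<le>n. if card J = k then H J (n - k) else 0)"
    by (rule sum.swap)
  also have "\<dots> = (\<Sum>J\<in>Pow (alphabet r). \<Sum>w | (J, w) \<in> koszul_index (alphabet r) n.
      (-1) ^ card J * alt_sum J (sort w) (sorted_list_of_set J @ w))"
  proof (rule sum.cong[OF refl])
    fix J assume J: "J \<in> Pow (alphabet r)"
    then have "finite J" by (rule finite_subset_alphabet)
    show "(\<Sum>k\<le>n. if card J = k then H J (n - k) else 0) =
        (\<Sum>w | (J, w) \<in> koszul_index (alphabet r) n.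
          (-1) ^ card J * alt_sum J (sort w) (sorted_list_of_set J @ w))"
    proof (cases "card J \<le> n")
      case True
      then have idx: "{w. (J, w) \<in> koszul_index (alphabet r) n} = words_of_length r (n - card J)"
        using J by (auto simp: koszul_index_def words_of_length_def)
      have "g (zip (p @ sort w) (sorted_list_of_set J @ w)) =
          g (zip p (sorted_list_of_set J) @ zip (sort w) w)" if "p \<in> permutations_of_set J" for p w
        using that \<open>finite J\<close> by (auto simp: permutations_of_set_def distinct_card)
      then have "(\<Sum>w\<in>words_of_length r (n - card J).
          (-1) ^ card J * alt_sum J (sort w) (sorted_list_of_set J @ w)) = H J (n - card J)"
        unfolding H_def alt_sum_def sum_distrib_left by (subst sum.swap) (intro sum.cong refl, simp)
      then show ?thesis using True unfolding idx by simp
    next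
      case False
      then show ?thesis by (auto simp: koszul_index_def intro!: sum.neutral)
    qed
  qed
  also have "\<dots> = (\<Sum>(J, w)\<in>koszul_index (alphabet r) n.
      (-1) ^ card J * alt_sum J (sort w) (sorted_list_of_set J @ w))"
  proof -
    have "finite {w. (J, w) \<in> koszul_index (alphabet r) n}" for J
      by (rule finite_subset[of _ "snd ` koszul_index (alphabet r) n"])
         (use finite_koszul_index[of "alphabet r" n] in force)+
    moreover have "koszul_index (alphabet r) n =
        Sigma (Pow (alphabet r)) (\<lambda>J. {w. (J, w) \<in> koszul_index (alphabet r) n})"
      by (auto simp: koszul_index_def)
    ultimately show ?thesis by (subst sum.Sigma) auto
  qed
  also have "\<dots> = (if n = 0 then g [] else 0)"
  proof (cases "n = 0")
    case True
    have "koszul_index (alphabet r) 0 = {({}, [])}"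
      using finite_subset_alphabet[of _ r] by (auto simp: koszul_index_def)
    then show ?thesis using True by (simp add: alt_sum_def)
  qed (simp add: alternating_sum_eq_0)
  finally show ?thesis .
qed

subsection \<open>Membership in the ideal\<close>

text \<open>No restriction to an alphabet is needed here: a step permutes the letters of each row.\<close>

definition SH_step :: "biword \<Rightarrow> biword \<Rightarrow> bool" where
  "SH_step u v \<longleftrightarrow> (\<exists>s t x y a b. x > y \<and> u = s @ [(x, a), (y, b)] @ t \<and>
     (V x y a b > 0 \<and> v = s @ [(y, a), (x, b)] @ t \<or> V x y a b < 0 \<and> v = s @ [(y, b), (x, a)] @ t))"

definition SH_rep :: "biword \<Rightarrow> biword" where
  "SH_rep u = (SOME v. equivclp SH_step u v)"

lemma equivclp_SH_rep: "equivclp SH_step u (SH_rep u)"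
  unfolding SH_rep_def by (rule someI) (rule equivclp_refl)

text \<open>Equivalent biwords define the same predicate, so the choice operator returns the same
  representative.\<close>

lemma SH_rep_cong:
  assumes "SH_step u v"
  shows "SH_rep u = SH_rep v"
proof -
  have "equivclp SH_step u = equivclp SH_step v"
    using assms by (blast intro: equivclp_trans equivclp_sym)
  then show ?thesis by (simp add: SH_rep_def)
qed

text \<open>A vanishing factor would make \<open>2 * a\<close> odd.\<close>

lemma V_neq_0: "V x y a b \<noteq> 0"
proof -
  have "real a - real x - 1/2 \<noteq> 0" for a x :: nat
  proof
    assume "real a - real x - 1/2 = 0"
    then have "real (2 * a) = real (2 * x + 1)" by simp
    then have "2 * a = 2 * x + 1" by (simp only: of_nat_eq_iff)
    then show False by presburger
  qed
  then show ?thesis by (simp add: V_def)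
qed

lemma V_commute: "V x y b a = V x y a b"
  by (simp add: V_def)

lemma SH_rep_pos:
  assumes "x > y" "V x y a b > 0"
  shows "SH_rep (s @ [(x, a), (y, b)] @ t) = SH_rep (s @ [(y, a), (x, b)] @ t)"
  by (rule SH_rep_cong) (use assms in \<open>unfold SH_step_def, blast\<close>)

lemma SH_rep_neg:
  assumes "x > y" "V x y a b < 0"
  shows "SH_rep (s @ [(x, a), (y, b)] @ t) = SH_rep (s @ [(y, b), (x, a)] @ t)"
  by (rule SH_rep_cong) (use assms in \<open>unfold SH_step_def, blast\<close>)

text \<open>By symmetry of \<open>V\<close> in \<open>a\<close> and \<open>b\<close>, both terms on
  the left fall under the same kind of relation. They match the terms on the right in order if
  \<open>V\<close> is positive and crosswise if it is negative. Exchanging \<open>x\<close> and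
  \<open>y\<close> exchanges the two sides, which settles \<open>x < y\<close>.\<close>

lemma right_quantum_SH_rep: "right_quantum (\<lambda>u. if SH_rep u = v then 1 else 0)"
proof -
  let ?f = "\<lambda>u. if SH_rep u = v then 1 else 0 :: int"
  have rq: "?f (s @ [(x, a), (y, b)] @ t) + ?f (s @ [(x, b), (y, a)] @ t) =
      ?f (s @ [(y, a), (x, b)] @ t) + ?f (s @ [(y, b), (x, a)] @ t)" if "x > y" for s t x y a b
  proof (cases "V x y a b > 0")
    case True
    then show ?thesis
      using SH_rep_pos[OF that, of a b s t] SH_rep_pos[OF that, of b a s t] V_commute[of x y a b]
      by simp
  next
    case False
    then have "V x y a b < 0" using V_neq_0[of x y a b] by linarith
    then show ?thesis
      using SH_rep_neg[OF that, of a b s t] SH_rep_neg[OF that, of b a s t] V_commute[of x y a b]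
      by simp
  qed
  show ?thesis
  proof
    fix s t x y a b
    consider "x > y" | "x = y" | "x < (y::nat)" by linarith
    then show "?f (s @ [(x, a), (y, b)] @ t) + ?f (s @ [(x, b), (y, a)] @ t) =
        ?f (s @ [(y, a), (x, b)] @ t) + ?f (s @ [(y, b), (x, a)] @ t)"
    proof cases
      case 1
      then show ?thesis by (rule rq)
    next
      case 2
      then show ?thesis by simp
    next
      case 3
      then show ?thesis using rq[of x y s a b t] by linarith
    qed
  qed
qed

lemma series_mult_single: "series_mult (single u) (single v) = single (u @ v)"
proof
  fix w
  have eq: "single u (take k w) * single v (drop k w) =
      (if k = length u then single (u @ v) w else 0)" if "k \<le> length w" for k
  proof (cases "k = length u")
    case True
    have "w = u @ v \<longleftrightarrow> take k w = u \<and> drop k w = v"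
      unfolding True by (metis append_eq_conv_conj)
    then show ?thesis using True by (simp add: single_def)
  next
    case False
    then have "take k w \<noteq> u" using that by auto
    then show ?thesis using False by (simp add: single_def)
  qed
  show "series_mult (single u) (single v) w = single (u @ v) w"
  proof (cases "length u \<le> length w")
    case True
    then show ?thesis by (simp add: series_mult_def eq)
  next
    case False
    then have "single (u @ v) w = 0" by (auto simp: single_def)
    then show ?thesis by (simp add: series_mult_def eq)
  qed
qed

section \<open>Differences of equivalent biwords in the ideal\<close>

lemma series_mult_minus:
  "series_mult (E - F) G = series_mult E G - series_mult F G"
  "series_mult G (E - F) = series_mult G E - series_mult G F"
  by (auto simp: series_mult_def algebra_simps sum_subtractf fun_eq_iff)

lemma ideal_SH_ideal: "ideal (SH_ideal r) (biword_algebra r)"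
  unfolding SH_ideal_def
  by (rule ring.genideal_ideal[OF ring_biword_algebra SH_generators_closed])

lemma SH_ideal_closed:
  shows "(\<lambda>_. 0) \<in> SH_ideal r"
    and "E \<in> SH_ideal r \<Longrightarrow> F \<in> SH_ideal r \<Longrightarrow> (\<lambda>u. E u + F u) \<in> SH_ideal r"
    and "E \<in> SH_ideal r \<Longrightarrow> (\<lambda>u. c * E u) \<in> SH_ideal r"
proof -
  interpret ideal "SH_ideal r" "biword_algebra r" by (rule ideal_SH_ideal)
  show "(\<lambda>_. 0) \<in> SH_ideal r" using additive_subgroup.zero_closed[OF additive_subgroup_axioms] by (simp add: biword_algebra_def)
  show "(\<lambda>u. E u + F u) \<in> SH_ideal r" if "E \<in> SH_ideal r" "F \<in> SH_ideal r"
    using additive_subgroup.a_closed[OF additive_subgroup_axioms that] by (simp add: biword_algebra_def)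
  \<comment> \<open>An integer scalar acts as left multiplication by that multiple of the unit, so
    the ideal absorbs it.\<close>
  have "(\<lambda>u. c * single [] u) \<in> carrier (biword_algebra r)"
    by (auto simp: biword_algebra_def dest: single_Nil_closed)
  moreover have "series_mult (\<lambda>u. c * single [] u) E = (\<lambda>u. c * E u)" for E
  proof -
    have "series_mult (\<lambda>u. c * single [] u) E = (\<lambda>u. c * series_mult (single []) E u)"
      by (simp add: series_mult_def sum_distrib_left mult.assoc)
    then show ?thesis by (simp add: series_mult_one_left)
  qed
  ultimately show "(\<lambda>u. c * E u) \<in> SH_ideal r" if "E \<in> SH_ideal r"
    using I_l_closed[OF that, of "\<lambda>u. c * single [] u"] by (simp add: biword_algebra_def)
qed

lemma SH_ideal_sum:
  assumes "finite S" "\<And>u. u \<in> S \<Longrightarrow> G u \<in> SH_ideal r"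
  shows "(\<lambda>v. \<Sum>u\<in>S. c u * G u v) \<in> SH_ideal r"
  using assms
proof (induction S rule: finite_induct)
  case empty
  then show ?case using SH_ideal_closed(1) by simp
next
  case (insert u S)
  then show ?case
    using SH_ideal_closed(2)[OF SH_ideal_closed(3)[of "G u" r "c u"]] by simp
qed

text \<open>The difference is a generator multiplied by \<open>single s\<close> on the left and
  \<open>single t\<close> on the right. The first claim keeps chains of steps inside the
  alphabet.\<close>

lemma SH_step_ideal:
  assumes "SH_step u v"
  shows "u \<in> biwords r \<longleftrightarrow> v \<in> biwords r"
    and "u \<in> biwords r \<Longrightarrow> single u - single v \<in> SH_ideal r"
proof -
  obtain s t x y a b where xy: "x > y" and u: "u = s @ [(x, a), (y, b)] @ t"
    and v: "V x y a b > 0 \<and> v = s @ [(y, a), (x, b)] @ t \<or>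
            V x y a b < 0 \<and> v = s @ [(y, b), (x, a)] @ t"
    using assms unfolding SH_step_def by blast
  show "u \<in> biwords r \<longleftrightarrow> v \<in> biwords r"
    using u v by (auto simp: biwords_def)
  assume "u \<in> biwords r"
  then have s: "s \<in> biwords r" "t \<in> biwords r" and letters: "{x, y, a, b} \<subseteq> alphabet r"
    using u by (auto simp: biwords_def)
  obtain d where d: "v = s @ d @ t" "([(x, a), (y, b)], d) \<in> SH r"
    using v xy letters that unfolding SH_def biword_def by fastforce
  have carrier: "single w \<in> carrier (biword_algebra r)" if "w \<in> biwords r" for w
    using that by (auto simp: biword_algebra_def single_def)
  interpret ideal "SH_ideal r" "biword_algebra r" by (rule ideal_SH_ideal)
  have "single [(x, a), (y, b)] - single d \<in> SH_ideal r"
    using d(2) ring.genideal_self[OF ring_biword_algebra SH_generators_closed]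
    unfolding SH_ideal_def by blast
  from I_r_closed[OF I_l_closed[OF this carrier[OF s(1)]] carrier[OF s(2)]]
  have "series_mult (series_mult (single s) (single [(x, a), (y, b)] - single d)) (single t) \<in> SH_ideal r"
    by (simp add: biword_algebra_def)
  then show "single u - single v \<in> SH_ideal r"
    by (simp add: series_mult_minus series_mult_single u d(1))
qed

text \<open>The differences telescope along a chain of steps; a step taken backwards contributes a
  negated difference.\<close>

lemma equivclp_SH_step_ideal:
  assumes "equivclp SH_step u v" "u \<in> biwords r"
  shows "v \<in> biwords r \<and> single u - single v \<in> SH_ideal r"
  using assms(1)
proof (induction rule: equivclp_induct)
  case base
  show ?case using assms(2) SH_ideal_closed(1) by (simp add: fun_diff_def)
next
  case (step v w)
  have "w \<in> biwords r" using step SH_step_ideal(1) by blast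
  moreover have "(\<lambda>z. single v z - single w z) \<in> SH_ideal r"
  proof (cases "SH_step v w")
    case True
    then show ?thesis using SH_step_ideal(2)[of v w r] step.IH by (simp add: fun_diff_def)
  next
    case False
    then have "single w - single v \<in> SH_ideal r"
      using SH_step_ideal(2)[of w v r] step.hyps \<open>w \<in> biwords r\<close> by blast
    from SH_ideal_closed(3)[OF this, of "-1"] show ?thesis by simp
  qed
  ultimately show ?case
    using SH_ideal_closed(2)[of "single u - single v" r "\<lambda>z. single v z - single w z"] step.IH
    by (simp add: fun_diff_def)
qed

text \<open>\<open>E\<close> equals the finite combination of the differences
  \<open>single u - single (SH_rep u)\<close> with coefficients \<open>E u\<close>. Indeed, the
  coefficient at \<open>v\<close> of the subtracted part is the pairing of \<open>E\<close> with the
  indicator of \<open>SH_rep u = v\<close>, which is zero.\<close>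

lemma SH_ideal_if_pairings_vanish:
  assumes supp: "\<And>u. E u \<noteq> 0 \<Longrightarrow> u \<in> biwords_of_length r n"
    and pairing: "\<And>g. right_quantum g \<Longrightarrow> (\<Sum>u\<in>biwords_of_length r n. E u * g u) = 0"
  shows "E \<in> SH_ideal r"
proof -
  let ?B = "biwords_of_length r n"
  have "single u - single (SH_rep u) \<in> SH_ideal r" if "u \<in> ?B" for u
    using that equivclp_SH_step_ideal[OF equivclp_SH_rep] by (simp add: biwords_of_length_def)
  then have "(\<lambda>v. \<Sum>u\<in>?B. E u * (single u - single (SH_rep u)) v) \<in> SH_ideal r"
    by (intro SH_ideal_sum) (simp_all only: finite_biwords_of_length)
  moreover have "(\<Sum>u\<in>?B. E u * (single u - single (SH_rep u)) v) = E v" for v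
  proof -
    have "(\<Sum>u\<in>?B. E u * (single u - single (SH_rep u)) v) =
        (\<Sum>u\<in>?B. single v u * E u) - (\<Sum>u\<in>?B. E u * (if SH_rep u = v then 1 else 0))"
      unfolding sum_subtractf[symmetric] by (intro sum.cong) (auto simp: single_def)
    also have "\<dots> = E v"
      using supp[of v] pairing[OF right_quantum_SH_rep] by (auto simp: sum_single_mult)
    finally show ?thesis .
  qed
  ultimately show ?thesis by simp
qed

lemma Ferm_closed: "Ferm r u \<noteq> 0 \<Longrightarrow> u \<in> biwords r"
proof (rule ccontr)
  assume "Ferm r u \<noteq> 0" "u \<notin> biwords r"
  moreover have "single (zip p (sorted_list_of_set J)) u = 0"
    if "J \<in> Pow (alphabet r)" "p \<in> permutations_of_set J" for J p
  proof -
    have "finite J" using that(1) by (rule finite_subset_alphabet)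
    then have "zip p (sorted_list_of_set J) \<in> biwords r"
      using that by (intro zip_in_biwords) (auto simp: permutations_of_set_def)
    then show ?thesis using \<open>u \<notin> biwords r\<close> by (auto simp: single_def)
  qed
  ultimately show False by (simp add: Ferm_eq)
qed

lemma Bos_closed:
  assumes "Bos r u \<noteq> 0"
  shows "u \<in> biwords r"
proof -
  have "{w \<in> lists (alphabet r). biword (sort w) w = u} \<noteq> {}"
    using assms unfolding Bos_def by (metis card.empty of_nat_0)
  then obtain w where "set w \<subseteq> alphabet r" "u = zip (sort w) w"
    by (auto simp: biword_def)
  then show ?thesis by (simp add: zip_in_biwords)
qed

theorem mainTheorem6:
  fixes r :: nat
  assumes "r \<ge> 1"
  shows "cong_SH r (Ferm r \<otimes>\<^bsub>biword_algebra r\<^esub> Bos r) \<one>\<^bsub>biword_algebra r\<^esub>"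
proof -
  let ?P = "series_mult (Ferm r) (Bos r)"
  have "homogeneous_component n (?P - single []) \<in> SH_ideal r" for n
  proof (rule SH_ideal_if_pairings_vanish)
    fix u assume "homogeneous_component n (?P - single []) u \<noteq> 0"
    then have "length u = n" "?P u \<noteq> 0 \<or> single [] u \<noteq> 0"
      by (auto simp: homogeneous_component_def split: if_splits)
    then show "u \<in> biwords_of_length r n"
      using series_mult_closed[of "Ferm r" r "Bos r" u] Ferm_closed Bos_closed
        single_Nil_closed[of u r] by (auto simp: biwords_of_length_def)
  next
    fix g :: "biword \<Rightarrow> int" assume g: "right_quantum g"
    have "(\<Sum>u\<in>biwords_of_length r n. homogeneous_component n (?P - single []) u * g u) =
        (\<Sum>u\<in>biwords_of_length r n. ?P u * g u) - (\<Sum>u\<in>biwords_of_length r n. single [] u * g u)"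
      unfolding sum_subtractf[symmetric]
      by (intro sum.cong) (auto simp: homogeneous_component_def biwords_of_length_def left_diff_distrib)
    also have "\<dots> = 0"
    proof -
      \<comment> \<open>The unit pairs to \<open>g []\<close> in degree 0 and to zero in every other
        degree, exactly like the product.\<close>
      have "[] \<in> biwords_of_length r n \<longleftrightarrow> n = 0"
        by (auto simp: biwords_of_length_def biwords_def)
      then show ?thesis using Ferm_Bos_pairing[OF g, of r n] by (simp add: sum_single_mult)
    qed
    finally show "(\<Sum>u\<in>biwords_of_length r n. homogeneous_component n (?P - single []) u * g u) = 0" .
  qed
  then show ?thesis by (simp add: cong_SH_def biword_algebra_def)
qed

end
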